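(* There exist model-defining $\mathbb{T}$-interpretations $\pi_A,\pi_B$ such that Spoiler has a winning strategy in $G_1(\pi_A,\pi_B)$ although $\pi_A\equiv\pi_B$.
   Context: $\mathbb{T}=(\mathbb{R}_+^\infty,\min,+,\infty,0)$ is the tropical semiring (addition $\min$, multiplication ordinary $+$, zero $\infty$, one $0$); infinite sums are infima and infinite products are ordinary (possibly infinite) sums of reals. For a finite relational vocabulary $\tau$ and universe $A$ (possibly infinite), a $\mathbb{T}$-interpretation maps the literals $R\bar a,\neg R\bar a$ to $\mathbb{R}_+^\infty$; model-defining if exactly one of $\pi(R\bar a),\pi(\neg R\bar a)$ is $\infty$ for every atom. Formulae in negation normal form are evaluated with equalities by truth value ($0$ for true, $\infty$ for false), literals by $\pi$, $\vee,\exists$ by $\min$/infimum, $\wedge,\forall$ by ordinary addition. $\equiv$: equal values for all sentences. $G_1(\pi_A,\pi_B)$: Spoiler picks an element of one universe, Duplicator one of the other; Duplicator wins iff $\pi_A(L(a))=\pi_B(L(b))$ for all $\tau$-literals $L(x)$ in one variable. *)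

theory Defs
  imports "HOL-Analysis.Analysis"
begin

text \<open>The carrier of the tropical semiring is \<^typ>\<open>ennreal\<close>. Semiring addition is \<^const>\<open>min\<close>
  (infinitary: \<^const>\<open>Inf\<close>), semiring multiplication is ordinary \<open>+\<close> (infinitary: \<^const>\<open>infsum\<close>,
  which on \<^typ>\<open>ennreal\<close> always exists and is the supremum of the finite partial sums);
  the semiring zero is \<open>\<infinity>\<close> and the semiring one is the real number \<open>0\<close>.\<close>

type_synonym tropical = ennreal

text \<open>Literals with arguments in \<open>'x\<close>: variables when they occur in formulae, elements of the
  universe when they are the arguments of an interpretation.\<close>

datatype (dead 'r, args: 'x) lit = Pos 'r "'x list" | Neg 'r "'x list"
  for map: map_lit

text \<open>A vocabulary is a set \<open>\<tau>\<close> of relation symbols together with an arity function \<open>ar\<close>.\<close>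

fun lit_over :: "'r set \<Rightarrow> ('r \<Rightarrow> nat) \<Rightarrow> ('r, 'x) lit \<Rightarrow> bool" where
  "lit_over \<tau> ar (Pos R xs) \<longleftrightarrow> R \<in> \<tau> \<and> length xs = ar R"
| "lit_over \<tau> ar (Neg R xs) \<longleftrightarrow> R \<in> \<tau> \<and> length xs = ar R"

text \<open>An interpretation with universe \<open>A\<close> is represented by a total function; its values on
  literals that are not over \<open>\<tau>\<close> and \<open>A\<close> are irrelevant.\<close>

type_synonym ('r, 'a) interp = "('r, 'a) lit \<Rightarrow> tropical"

definition model_defining ::
  "'r set \<Rightarrow> ('r \<Rightarrow> nat) \<Rightarrow> 'a set \<Rightarrow> ('r, 'a) interp \<Rightarrow> bool" where
  "model_defining \<tau> ar A \<pi> \<longleftrightarrow>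
     (\<forall>R\<in>\<tau>. \<forall>as. length as = ar R \<and> set as \<subseteq> A \<longrightarrow>
        (\<pi> (Pos R as) = \<infinity>) \<noteq> (\<pi> (Neg R as) = \<infinity>))"

datatype 'r fm =
    Lit "('r, nat) lit"
  | Eq nat nat
  | Neq nat nat
  | Or "'r fm" "'r fm"
  | And "'r fm" "'r fm"
  | Exists nat "'r fm"
  | Forall nat "'r fm"

primrec fm_over :: "'r set \<Rightarrow> ('r \<Rightarrow> nat) \<Rightarrow> 'r fm \<Rightarrow> bool" where
  "fm_over \<tau> ar (Lit L) \<longleftrightarrow> lit_over \<tau> ar L"
| "fm_over \<tau> ar (Eq x y) \<longleftrightarrow> True"
| "fm_over \<tau> ar (Neq x y) \<longleftrightarrow> True"
| "fm_over \<tau> ar (Or \<phi> \<psi>) \<longleftrightarrow> fm_over \<tau> ar \<phi> \<and> fm_over \<tau> ar \<psi>"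
| "fm_over \<tau> ar (And \<phi> \<psi>) \<longleftrightarrow> fm_over \<tau> ar \<phi> \<and> fm_over \<tau> ar \<psi>"
| "fm_over \<tau> ar (Exists x \<phi>) \<longleftrightarrow> fm_over \<tau> ar \<phi>"
| "fm_over \<tau> ar (Forall x \<phi>) \<longleftrightarrow> fm_over \<tau> ar \<phi>"

primrec fv :: "'r fm \<Rightarrow> nat set" where
  "fv (Lit L) = args L"
| "fv (Eq x y) = {x, y}"
| "fv (Neq x y) = {x, y}"
| "fv (Or \<phi> \<psi>) = fv \<phi> \<union> fv \<psi>"
| "fv (And \<phi> \<psi>) = fv \<phi> \<union> fv \<psi>"
| "fv (Exists x \<phi>) = fv \<phi> - {x}"
| "fv (Forall x \<phi>) = fv \<phi> - {x}"

definition sentence_over :: "'r set \<Rightarrow> ('r \<Rightarrow> nat) \<Rightarrow> 'r fm \<Rightarrow> bool" where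
  "sentence_over \<tau> ar \<phi> \<longleftrightarrow> fm_over \<tau> ar \<phi> \<and> fv \<phi> = {}"

primrec fm_value :: "'a set \<Rightarrow> ('r, 'a) interp \<Rightarrow> (nat \<Rightarrow> 'a) \<Rightarrow> 'r fm \<Rightarrow> tropical" where
  "fm_value A \<pi> \<beta> (Lit L) = \<pi> (map_lit \<beta> L)"
| "fm_value A \<pi> \<beta> (Eq x y) = (if \<beta> x = \<beta> y then 0 else \<infinity>)"
| "fm_value A \<pi> \<beta> (Neq x y) = (if \<beta> x \<noteq> \<beta> y then 0 else \<infinity>)"
| "fm_value A \<pi> \<beta> (Or \<phi> \<psi>) = min (fm_value A \<pi> \<beta> \<phi>) (fm_value A \<pi> \<beta> \<psi>)"
| "fm_value A \<pi> \<beta> (And \<phi> \<psi>) = fm_value A \<pi> \<beta> \<phi> + fm_value A \<pi> \<beta> \<psi>"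
| "fm_value A \<pi> \<beta> (Exists x \<phi>) = (INF a\<in>A. fm_value A \<pi> (\<beta>(x := a)) \<phi>)"
| "fm_value A \<pi> \<beta> (Forall x \<phi>) = (\<Sum>\<^sub>\<infinity>a\<in>A. fm_value A \<pi> (\<beta>(x := a)) \<phi>)"

lemma fm_value_cong:
  assumes "\<And>x. x \<in> fv \<phi> \<Longrightarrow> \<beta> x = \<gamma> x"
  shows "fm_value A \<pi> \<beta> \<phi> = fm_value A \<pi> \<gamma> \<phi>"
  using assms
proof (induction \<phi> arbitrary: \<beta> \<gamma>)
  case (Lit L)
  then have "map_lit \<beta> L = map_lit \<gamma> L"
    by (auto intro: lit.map_cong)
  then show ?case by simp
next
  case (Or \<phi> \<psi>)
  have "fm_value A \<pi> \<beta> \<phi> = fm_value A \<pi> \<gamma> \<phi>" "fm_value A \<pi> \<beta> \<psi> = fm_value A \<pi> \<gamma> \<psi>"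
    using Or.prems by (auto intro!: Or.IH)
  then show ?case by simp
next
  case (And \<phi> \<psi>)
  have "fm_value A \<pi> \<beta> \<phi> = fm_value A \<pi> \<gamma> \<phi>" "fm_value A \<pi> \<beta> \<psi> = fm_value A \<pi> \<gamma> \<psi>"
    using And.prems by (auto intro!: And.IH)
  then show ?case by simp
next
  case (Exists x \<phi>)
  have "fm_value A \<pi> (\<beta>(x := a)) \<phi> = fm_value A \<pi> (\<gamma>(x := a)) \<phi>" for a
    using Exists.prems by (intro Exists.IH) auto
  then show ?case by simp
next
  case (Forall x \<phi>)
  have "fm_value A \<pi> (\<beta>(x := a)) \<phi> = fm_value A \<pi> (\<gamma>(x := a)) \<phi>" for a
    using Forall.prems by (intro Forall.IH) auto
  then show ?case by simp
qed auto

text \<open>By \<open>fm_value_cong\<close> the chosen assignment does not affect the value of a sentence.\<close>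

definition sentence_value :: "'a set \<Rightarrow> ('r, 'a) interp \<Rightarrow> 'r fm \<Rightarrow> tropical" where
  "sentence_value A \<pi> \<phi> = fm_value A \<pi> (\<lambda>_. SOME a. a \<in> A) \<phi>"

definition elem_equiv ::
  "'r set \<Rightarrow> ('r \<Rightarrow> nat) \<Rightarrow> 'a set \<Rightarrow> ('r, 'a) interp \<Rightarrow> 'b set \<Rightarrow> ('r, 'b) interp \<Rightarrow> bool" where
  "elem_equiv \<tau> ar A \<pi>A B \<pi>B \<longleftrightarrow>
     (\<forall>\<phi>. sentence_over \<tau> ar \<phi> \<longrightarrow> sentence_value A \<pi>A \<phi> = sentence_value B \<pi>B \<phi>)"

text \<open>The winning condition of Duplicator for the play in which \<open>a\<close> and \<open>b\<close> were chosen. The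
  literals in one variable are those whose arguments all equal the variable \<open>0\<close>.\<close>

definition duplicator_wins_play ::
  "'r set \<Rightarrow> ('r \<Rightarrow> nat) \<Rightarrow> ('r, 'a) interp \<Rightarrow> ('r, 'b) interp \<Rightarrow> 'a \<Rightarrow> 'b \<Rightarrow> bool" where
  "duplicator_wins_play \<tau> ar \<pi>A \<pi>B a b \<longleftrightarrow>
     (\<forall>L :: ('r, nat) lit. lit_over \<tau> ar L \<and> args L \<subseteq> {0} \<longrightarrow>
        \<pi>A (map_lit (\<lambda>_. a) L) = \<pi>B (map_lit (\<lambda>_. b) L))"

text \<open>A strategy of Spoiler in the one-round game is the choice of one of the two universes and
  of an element of it.\<close>

definition spoiler_wins_G1 ::
  "'r set \<Rightarrow> ('r \<Rightarrow> nat) \<Rightarrow> 'a set \<Rightarrow> ('r, 'a) interp \<Rightarrow> 'b set \<Rightarrow> ('r, 'b) interp \<Rightarrow> bool" where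
  "spoiler_wins_G1 \<tau> ar A \<pi>A B \<pi>B \<longleftrightarrow>
     (\<exists>a\<in>A. \<forall>b\<in>B. \<not> duplicator_wins_play \<tau> ar \<pi>A \<pi>B a b) \<or>
     (\<exists>b\<in>B. \<forall>a\<in>A. \<not> duplicator_wins_play \<tau> ar \<pi>A \<pi>B a b)"

end

theory Submission imports Defs begin

text \<open>A bijection between the universes that distorts all literal values by at most a constant
  factor \<open>c\<close> distorts the values of all formulae by at most the same factor, because minima, sums,
  infima and infinite sums are monotone and positively homogeneous. So two interpretations are
  elementarily equivalent as soon as such bijections exist for \<open>c\<close> arbitrarily close to \<open>1\<close>.
  This is the case for a single unary relation with the values \<open>1 + 1 / n\<close>, \<open>n \<ge> 1\<close>, in one structure
  and the additional value \<open>1\<close> in the other one: send the element of value \<open>1\<close> to the one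
  of value \<open>1 + 1 / m\<close> and shift all later elements by one. Spoiler wins by choosing the
  element of value \<open>1\<close>.\<close>

text \<open>Since \<open>0 < c < \<infinity>\<close>, dividing by \<open>c\<close> can be undone, so
  the left side over \<open>c\<close> is a lower bound of all \<open>g a\<close>.\<close>

lemma INF_le_cmult_INF_ennreal:
  fixes c :: ennreal
  assumes "0 < c" "c < \<infinity>" and le: "\<And>a. a \<in> A \<Longrightarrow> \<exists>b\<in>B. f b \<le> c * g a"
  shows "(INF b\<in>B. f b) \<le> c * (INF a\<in>A. g a)"
proof -
  have "(INF b\<in>B. f b) / c \<le> (INF a\<in>A. g a)"
  proof (rule INF_greatest)
    fix a assume "a \<in> A"
    then have "(INF b\<in>B. f b) \<le> c * g a"
      using le by (meson INF_lower order_trans)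
    then show "(INF b\<in>B. f b) / c \<le> g a"
      using assms(1) by (auto intro: divide_le_posI_ennreal simp: mult.commute)
  qed
  then have "c * ((INF b\<in>B. f b) / c) \<le> c * (INF a\<in>A. g a)"
    by (rule mult_left_mono) simp
  moreover have "c * ((INF b\<in>B. f b) / c) = (INF b\<in>B. f b)"
    using assms(1,2) by (simp add: ennreal_times_divide mult.commute[of c] ennreal_mult_divide_eq)
  ultimately show ?thesis by simp
qed

text \<open>An infinite sum in \<open>ennreal\<close> is the supremum of its finite partial sums,
  and each of these obeys the bound termwise.\<close>

lemma infsum_le_cmult_infsum_ennreal:
  fixes f g :: "'a \<Rightarrow> ennreal"
  assumes "\<And>a. a \<in> A \<Longrightarrow> f a \<le> c * g a"
  shows "infsum f A \<le> c * infsum g A"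
proof -
  have "sum f F \<le> c * infsum g A" if F: "finite F" "F \<subseteq> A" for F
  proof -
    have "sum f F \<le> c * sum g F"
      using assms F by (auto simp: sum_distrib_left intro!: sum_mono)
    also have "\<dots> \<le> c * infsum g A"
      using F by (intro mult_left_mono) (auto simp: nonneg_infsum_complete intro!: SUP_upper)
    finally show ?thesis .
  qed
  then show ?thesis
    by (subst nonneg_infsum_complete) (auto intro!: SUP_least)
qed

text \<open>Injectivity of \<open>h\<close> preserves inequality atoms, bijectivity reindexes the
  infinite sum of a universal quantifier, and positivity of \<open>c\<close> keeps false equalities
  at infinity after scaling. The bound is one-sided so that it can be applied separately to a
  bijection and to its inverse.\<close>

lemma fm_value_le_of_distortion:
  assumes h: "bij_betw h A B" and c: "1 \<le> c" "c < \<infinity>"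
    and lit: "\<And>L. lit_over \<tau> ar L \<Longrightarrow> args L \<subseteq> A \<Longrightarrow> \<pi>B (map_lit h L) \<le> c * \<pi>A L"
    and "range \<beta> \<subseteq> A" "fm_over \<tau> ar \<phi>"
  shows "fm_value B \<pi>B (\<lambda>x. h (\<beta> x)) \<phi> \<le> c * fm_value A \<pi>A \<beta> \<phi>"
  using assms(5,6)
proof (induction \<phi> arbitrary: \<beta>)
  case (Lit L)
  have "lit_over \<tau> ar (map_lit \<beta> L)"
    using Lit.prems by (cases L) auto
  moreover have "args (map_lit \<beta> L) \<subseteq> A"
    using Lit.prems by (auto simp: lit.set_map)
  ultimately show ?case
    using lit[of "map_lit \<beta> L"] by (simp add: lit.map_comp comp_def)
next
  case (Eq x y)
  show ?case
    using c by (auto simp: ennreal_mult_top)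
next
  case (Neq x y)
  have "h (\<beta> x) = h (\<beta> y) \<longleftrightarrow> \<beta> x = \<beta> y"
    using h Neq.prems(1) by (intro inj_on_eq_iff[of h A]) (auto simp: bij_betw_def)
  then show ?case
    using c by (auto simp: ennreal_mult_top)
next
  case (Or \<phi> \<psi>)
  have "fm_value B \<pi>B (\<lambda>x. h (\<beta> x)) \<phi> \<le> c * fm_value A \<pi>A \<beta> \<phi>"
    "fm_value B \<pi>B (\<lambda>x. h (\<beta> x)) \<psi> \<le> c * fm_value A \<pi>A \<beta> \<psi>"
    using Or.prems by (auto intro!: Or.IH)
  then show ?case
    by (auto simp: min_def)
next
  case (And \<phi> \<psi>)
  then show ?case
    by (simp add: distrib_left add_mono)
next
  case (Exists x \<phi>)
  have "fm_value B \<pi>B ((\<lambda>y. h (\<beta> y))(x := h a)) \<phi> \<le> c * fm_value A \<pi>A (\<beta>(x := a)) \<phi>"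
    if "a \<in> A" for a
  proof -
    have "range (\<beta>(x := a)) \<subseteq> A" "fm_over \<tau> ar \<phi>"
      using that Exists.prems by auto
    then have "fm_value B \<pi>B (\<lambda>y. h ((\<beta>(x := a)) y)) \<phi> \<le> c * fm_value A \<pi>A (\<beta>(x := a)) \<phi>"
      by (rule Exists.IH)
    moreover have "(\<lambda>y. h ((\<beta>(x := a)) y)) = (\<lambda>y. h (\<beta> y))(x := h a)"
      by auto
    ultimately show ?thesis by simp
  qed
  moreover have "0 < c"
    using c(1) by (rule less_le_trans[OF zero_less_one])
  ultimately show ?case
    using c(2) h by (auto intro!: INF_le_cmult_INF_ennreal simp: bij_betw_def)
next
  case (Forall x \<phi>)
  have "fm_value B \<pi>B ((\<lambda>y. h (\<beta> y))(x := h a)) \<phi> \<le> c * fm_value A \<pi>A (\<beta>(x := a)) \<phi>"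
    if "a \<in> A" for a
  proof -
    have "range (\<beta>(x := a)) \<subseteq> A" "fm_over \<tau> ar \<phi>"
      using that Forall.prems by auto
    then have "fm_value B \<pi>B (\<lambda>y. h ((\<beta>(x := a)) y)) \<phi> \<le> c * fm_value A \<pi>A (\<beta>(x := a)) \<phi>"
      by (rule Forall.IH)
    moreover have "(\<lambda>y. h ((\<beta>(x := a)) y)) = (\<lambda>y. h (\<beta> y))(x := h a)"
      by auto
    ultimately show ?thesis by simp
  qed
  then show ?case
    by (simp add: infsum_reindex_bij_betw[OF h, symmetric] infsum_le_cmult_infsum_ennreal)
qed

lemma sentence_value_le_of_distortion:
  assumes "bij_betw h A B" "A \<noteq> {}" "1 \<le> c" "c < \<infinity>"
    and "\<And>L. lit_over \<tau> ar L \<Longrightarrow> args L \<subseteq> A \<Longrightarrow> \<pi>B (map_lit h L) \<le> c * \<pi>A L"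
    and "sentence_over \<tau> ar \<phi>"
  shows "sentence_value B \<pi>B \<phi> \<le> c * sentence_value A \<pi>A \<phi>"
proof -
  let ?\<beta> = "\<lambda>_. SOME a. a \<in> A"
  \<comment> \<open>The default assignment of \<open>B\<close> need not be the
    \<open>h\<close>-image of that of \<open>A\<close>, but a sentence has no free
    variables.\<close>
  have "sentence_value B \<pi>B \<phi> = fm_value B \<pi>B (\<lambda>x. h (?\<beta> x)) \<phi>"
    unfolding sentence_value_def using assms(6)
    by (intro fm_value_cong) (simp add: sentence_over_def)
  also have "\<dots> \<le> c * sentence_value A \<pi>A \<phi>"
    unfolding sentence_value_def
  proof (rule fm_value_le_of_distortion[OF assms(1,3,4)])
    show "range ?\<beta> \<subseteq> A"
      using assms(2) by (auto intro: someI_ex)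
    show "fm_over \<tau> ar \<phi>"
      using assms(6) by (simp add: sentence_over_def)
  qed (rule assms(5))
  finally show ?thesis .
qed

text \<open>Let m tend to infinity. The limit of the product is safe even for infinite
  \<open>y\<close>, because the factors tend to 1 and not to 0.\<close>

lemma ennreal_le_of_le_cmult:
  fixes x y :: ennreal
  assumes "\<And>m. (0 :: nat) < m \<Longrightarrow> x \<le> ennreal (1 + 1 / real m) * y"
  shows "x \<le> y"
proof -
  have "(\<lambda>m. 1 + 1 / real (Suc m)) \<longlonglongrightarrow> 1 + 0"
    by (intro tendsto_intros LIMSEQ_Suc lim_1_over_n)
  then have "(\<lambda>m. ennreal (1 + 1 / real (Suc m)) * y) \<longlonglongrightarrow> ennreal (1 + 0) * y"
    by (intro tendsto_mult_ennreal tendsto_ennrealI tendsto_const) auto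
  moreover have "x \<le> ennreal (1 + 1 / real (Suc m)) * y" for m
    using assms[of "Suc m"] by simp
  ultimately show ?thesis
    by (auto intro: LIMSEQ_le_const)
qed

text \<open>At \<open>n = 0\<close> the convention \<open>1 / 0 = 0\<close> produces the limit value \<open>1\<close>.\<close>

definition weight :: "nat \<Rightarrow> ennreal" where
  "weight n = ennreal (1 + 1 / real n)"

text \<open>One function serves both structures, which differ only in whether the universe contains
  0. All atoms are true in both, so only their finite weights can tell elements apart.\<close>

fun weight_interp :: "(nat, nat) interp" where
  "weight_interp (Pos R xs) = weight (hd xs)"
| "weight_interp (Neg R xs) = \<infinity>"

definition shift_from :: "nat \<Rightarrow> nat \<Rightarrow> nat" where
  "shift_from m n = (if n = 0 then m else if n < m then n else Suc n)"

lemma weight_bounds: "1 \<le> weight n" "m \<le> n \<Longrightarrow> 0 < m \<Longrightarrow> weight n \<le> weight m"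
  by (auto simp: weight_def frac_le intro!: ennreal_leI)

lemma weight_0: "weight 0 = 1"
  by (simp add: weight_def)

lemma weight_eq_1_iff: "weight n = 1 \<longleftrightarrow> n = 0"
  by (auto simp: weight_def)

lemma bij_betw_shift_from:
  assumes "0 < m"
  shows "bij_betw (shift_from m) UNIV {0<..}"
proof -
  have "n \<in> range (shift_from m)" if "0 < n" for n
  proof -
    have "n = shift_from m (if n = m then 0 else if n < m then n else n - 1)"
      using that assms by (auto simp: shift_from_def)
    then show ?thesis by (rule range_eqI)
  qed
  moreover have "inj (shift_from m)"
    by (auto simp: shift_from_def inj_def split: if_splits)
  ultimately show ?thesis
    using assms by (auto simp: bij_betw_def shift_from_def)
qed

text \<open>Only 0 and the elements from \<open>m\<close> on are moved. Before and after the move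
  their weights lie between 1 and \<open>weight m\<close>, so the ratio in either direction is at
  most \<open>weight m\<close>.\<close>

lemma weight_shift_from_cases:
  assumes "0 < m"
  shows "shift_from m n = n \<or> weight n \<le> weight m \<and> weight (shift_from m n) \<le> weight m"
  using assms weight_bounds(2)[of m n] weight_bounds(2)[of m "Suc n"] weight_bounds(1)[of m]
  by (auto simp: shift_from_def weight_0)

lemma le_cmult_of_ge_1: "1 \<le> x \<Longrightarrow> y \<le> c \<Longrightarrow> y \<le> c * (x :: ennreal)"
  using mult_mono[of y c 1 x] by simp

lemma weight_distortion:
  assumes "0 < m"
  shows "weight (shift_from m n) \<le> weight m * weight n"
    and "weight n \<le> weight m * weight (shift_from m n)"
  using weight_shift_from_cases[OF assms, of n] weight_bounds(1)
    mult_mono[of 1 "weight m" "weight n" "weight n"]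
  by (auto intro: le_cmult_of_ge_1)

lemma weight_interp_equiv:
  assumes "\<And>R. ar R = 1"
  shows "elem_equiv \<tau> ar UNIV weight_interp {0<..} weight_interp"
  unfolding elem_equiv_def
\<comment> \<open>Every \<open>m\<close> brings its own bijection: \<open>shift_from m\<close>
  yields one inequality up to the factor \<open>weight m\<close>, its inverse the other.\<close>
proof (intro allI impI antisym; rule ennreal_le_of_le_cmult)
  fix \<phi> and m :: nat
  assume \<phi>: "sentence_over \<tau> ar \<phi>" and m: "0 < m"
  note bij = bij_betw_shift_from[OF m]
  let ?g = "inv_into UNIV (shift_from m)"
  have c: "1 \<le> weight m" "weight m < \<infinity>"
    using weight_bounds(1) by (auto simp: weight_def)
  \<comment> \<open>Arity 1 reduces positive literals to weights of single elements; for negative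
    ones both sides are infinite.\<close>
  have lit: "weight_interp (map_lit h L) \<le> weight m * weight_interp L"
    if "lit_over \<tau> ar L" "args L \<subseteq> A" "\<And>a. a \<in> A \<Longrightarrow> weight (h a) \<le> weight m * weight a" for h L A
    using that assms c by (cases L) (auto simp: length_Suc_conv ennreal_mult_top)
  have "sentence_value {0<..} weight_interp \<phi> \<le> weight m * sentence_value UNIV weight_interp \<phi>"
    using weight_distortion(1)[OF m]
    by (intro sentence_value_le_of_distortion[OF bij _ c _ \<phi>] lit) auto
  then show "sentence_value {0<..} weight_interp \<phi>
      \<le> ennreal (1 + 1 / real m) * sentence_value UNIV weight_interp \<phi>"
    by (simp add: weight_def)
  have "weight (?g a) \<le> weight m * weight a" if "a \<in> {0<..}" for a
    using weight_distortion(2)[OF m, of "?g a"] bij_betw_inv_into_right[OF bij that] by simp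
  then have "sentence_value UNIV weight_interp \<phi> \<le> weight m * sentence_value {0<..} weight_interp \<phi>"
    by (intro sentence_value_le_of_distortion[OF bij_betw_inv_into[OF bij] _ c _ \<phi>] lit) auto
  then show "sentence_value UNIV weight_interp \<phi>
      \<le> ennreal (1 + 1 / real m) * sentence_value {0<..} weight_interp \<phi>"
    by (simp add: weight_def)
qed

lemma model_defining_weight_interp: "model_defining \<tau> ar A weight_interp"
  by (auto simp: model_defining_def weight_def)

lemma spoiler_wins_weight_interp:
  assumes "R \<in> \<tau>" "ar R = 1"
  shows "spoiler_wins_G1 \<tau> ar UNIV weight_interp {0<..} weight_interp"
proof -
  \<comment> \<open>Spoiler picks the element 0, the only one of weight 1. In the witness
    \<open>Pos R [0]\<close> below, 0 is instead the variable of the literal.\<close>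
  have "\<not> duplicator_wins_play \<tau> ar weight_interp weight_interp 0 b" if "0 < b" for b
    using assms that weight_eq_1_iff[of b] unfolding duplicator_wins_play_def
    by (auto simp: weight_0 intro!: exI[of _ "Pos R [0]"])
  then show ?thesis
    by (auto simp: spoiler_wins_G1_def)
qed

theorem theorem4p9:
  "\<exists>(\<tau> :: nat set) (ar :: nat \<Rightarrow> nat) (A :: nat set) (B :: nat set)
      (\<pi>A :: (nat, nat) interp) (\<pi>B :: (nat, nat) interp).
     finite \<tau> \<and> A \<noteq> {} \<and> B \<noteq> {} \<and>
     model_defining \<tau> ar A \<pi>A \<and> model_defining \<tau> ar B \<pi>B \<and>
     spoiler_wins_G1 \<tau> ar A \<pi>A B \<pi>B \<and>
     elem_equiv \<tau> ar A \<pi>A B \<pi>B"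
proof (intro exI conjI)
  show "finite {0::nat}" "(UNIV :: nat set) \<noteq> {}" "{0::nat<..} \<noteq> {}"
    by auto
  show "spoiler_wins_G1 {0} (\<lambda>_. 1) UNIV weight_interp {0<..} weight_interp"
    by (rule spoiler_wins_weight_interp[of 0]) auto
  show "elem_equiv {0} (\<lambda>_. 1) UNIV weight_interp {0<..} weight_interp"
    by (rule weight_interp_equiv) simp
qed (rule model_defining_weight_interp)+

end
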